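(* Let $\mathbb{P}$ and $\mathbb{Q}$ be probability measures on a measurable space $(\mathcal{X},\mathcal{F})$ with $\mathbb{P}\gg\mathbb{Q}$ (i.e. $\mathbb{Q}$ is absolutely continuous with respect to $\mathbb{P}$), and let $\mathcal{F}_n\subseteq\mathcal{F}$ be a sub-$\sigma$-algebra. Let $\mathbb{P}_{\mathcal{F}_n}$ and $\mathbb{Q}_{\mathcal{F}_n}$ denote the restrictions of $\mathbb{P}$ and $\mathbb{Q}$ to $\mathcal{F}_n$. If $\varepsilon$ is the log-utility-optimal e-value for $\mathbb{P}$ against $\mathbb{Q}$, then $\varepsilon_n:=\mathbb{E}^{\mathbb{P}}[\varepsilon\mid\mathcal{F}_n]$ is the log-utility-optimal e-value for $\mathbb{P}_{\mathcal{F}_n}$ against $\mathbb{Q}_{\mathcal{F}_n}$.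
   Context: A valid e-value for $\mathbb{P}$ is a measurable map $\varepsilon:\mathcal{X}\to[0,\infty]$ with $\mathbb{E}^{\mathbb{P}}[\varepsilon]\le1$. For a simple hypothesis $\{\mathbb{P}\}$ and an alternative $\mathbb{Q}\ll\mathbb{P}$, the log-utility-optimal e-value (the optimizer of $\mathbb{E}^{\mathbb{Q}}[\log\varepsilon]$ over valid e-values) is the likelihood ratio, so "$\varepsilon$ is log-utility-optimal for $\mathbb{P}$ against $\mathbb{Q}$" means $\varepsilon=d\mathbb{Q}/d\mathbb{P}$, $\mathbb{P}$-almost surely. On $\mathcal{F}_n$, log-utility-optimality for $\mathbb{P}_{\mathcal{F}_n}$ against $\mathbb{Q}_{\mathcal{F}_n}$ is understood in the same way, for $\mathcal{F}_n$-measurable e-values. *)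

theory Defs
  imports "HOL-Probability.Probability"
begin

definition valid_e_value :: "'a measure \<Rightarrow> ('a \<Rightarrow> ennreal) \<Rightarrow> bool" where
  "valid_e_value P \<epsilon> \<longleftrightarrow> \<epsilon> \<in> borel_measurable P \<and> (\<integral>\<^sup>+ x. \<epsilon> x \<partial>P) \<le> 1"

text \<open>
  The following is meant for probability measures P, Q on the same \<open>\<sigma>\<close>-algebra with Q absolutely
  continuous with respect to P; otherwise \<^const>\<open>RN_deriv\<close> need not be a density of Q.
  Optimality is by convention equality with the likelihood ratio, rather than maximality of the
  Q-expectation of the logarithm: the latter need not be finite, or even well defined.
\<close>

definition log_utility_optimal :: "'a measure \<Rightarrow> 'a measure \<Rightarrow> ('a \<Rightarrow> ennreal) \<Rightarrow> bool" where
  "log_utility_optimal P Q \<epsilon> \<longleftrightarrow> valid_e_value P \<epsilon> \<and> (AE x in P. \<epsilon> x = RN_deriv P Q x)"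

end

theory Submission
  imports Defs
begin

text \<open>
  Let \<open>\<epsilon>\<close> be the density of \<open>Q\<close> with respect to \<open>P\<close>. For a set \<open>A\<close> in the smaller
  \<open>\<sigma>\<close>-algebra, the defining property of conditional expectation gives
  \<open>\<integral>\<^sub>A E[\<epsilon> | F\<^sub>n] dP = \<integral>\<^sub>A \<epsilon> dP = Q A\<close>; both ends only see \<open>P\<close> and \<open>Q\<close> on \<open>F\<^sub>n\<close>, and
  \<open>E[\<epsilon> | F\<^sub>n]\<close> is \<open>F\<^sub>n\<close>-measurable. So conditioning a density yields the density of the
  restricted measures (\<open>density_nn_cond_exp\<close>), and densities are almost surely unique. Taking
  for \<open>A\<close> the whole space shows that conditioning preserves the expectation, hence validity
  (\<open>valid_e_value_nn_cond_exp\<close>).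
\<close>

lemma (in sigma_finite_subalgebra) density_nn_cond_exp:
  assumes [measurable]: "f \<in> borel_measurable M"
  shows "density (restr_to_subalg M F) (nn_cond_exp M F f) = restr_to_subalg (density M f) F"
proof (rule measure_eqI)
  have subalg_density: "subalgebra (density M f) F"
    using subalg by (simp add: subalgebra_def)
  show "sets (density (restr_to_subalg M F) (nn_cond_exp M F f))
      = sets (restr_to_subalg (density M f) F)"
    by (simp add: sets_restr_to_subalg subalg subalg_density)
  fix A assume "A \<in> sets (density (restr_to_subalg M F) (nn_cond_exp M F f))"
  then have A [measurable]: "A \<in> sets F"
    by (simp add: sets_restr_to_subalg subalg)
  then have A_M: "A \<in> sets M"
    using subalg by (auto simp: subalgebra_def)
  have "emeasure (density (restr_to_subalg M F) (nn_cond_exp M F f)) A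
      = (\<integral>\<^sup>+ x \<in> A. nn_cond_exp M F f x \<partial>restr_to_subalg M F)"
    using A by (intro emeasure_density)
      (simp_all add: sets_restr_to_subalg measurable_in_subalg subalg)
  also have "\<dots> = (\<integral>\<^sup>+ x \<in> A. nn_cond_exp M F f x \<partial>M)"
    by (simp add: nn_integral_subalgebra2 subalg)
  also have "\<dots> = (\<integral>\<^sup>+ x \<in> A. f x \<partial>M)"
    using nn_cond_exp_intg[of "indicator A" f] by (simp add: mult.commute)
  also have "\<dots> = emeasure (density M f) A"
    using A_M by (simp add: emeasure_density)
  also have "\<dots> = emeasure (restr_to_subalg (density M f) F) A"
    by (simp add: emeasure_restr_to_subalg subalg_density A)
  finally show "emeasure (density (restr_to_subalg M F) (nn_cond_exp M F f)) A
      = emeasure (restr_to_subalg (density M f) F) A" .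
qed

lemma (in sigma_finite_subalgebra) valid_e_value_nn_cond_exp:
  assumes "valid_e_value M f"
  shows "valid_e_value (restr_to_subalg M F) (nn_cond_exp M F f)"
proof -
  have f: "f \<in> borel_measurable M" and le: "(\<integral>\<^sup>+ x. f x \<partial>M) \<le> 1"
    using assms by (auto simp: valid_e_value_def)
  have "(\<integral>\<^sup>+ x. nn_cond_exp M F f x \<partial>restr_to_subalg M F) = (\<integral>\<^sup>+ x. nn_cond_exp M F f x \<partial>M)"
    by (simp add: nn_integral_subalgebra2 subalg)
  also have "\<dots> = (\<integral>\<^sup>+ x. f x \<partial>M)"
    using nn_cond_exp_intg[of "\<lambda>_. 1" f] f by simp
  finally show ?thesis
    using le by (simp add: valid_e_value_def measurable_in_subalg subalg)
qed

theorem theorem7: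
  fixes P Q Fn :: "'a measure" and \<epsilon> :: "'a \<Rightarrow> ennreal"
  assumes "prob_space P" and "prob_space Q"
    and "sets Q = sets P"
    and "absolutely_continuous P Q"
    and "subalgebra P Fn"
    and "log_utility_optimal P Q \<epsilon>"
  shows "log_utility_optimal (restr_to_subalg P Fn) (restr_to_subalg Q Fn) (nn_cond_exp P Fn \<epsilon>)"
proof -
  interpret P: prob_space P by fact
  interpret finite_measure_subalgebra P Fn
    by unfold_locales fact
  interpret PF: sigma_finite_measure "restr_to_subalg P Fn"
    by (rule sigma_fin_subalg)
  have valid: "valid_e_value P \<epsilon>" and ae: "AE x in P. \<epsilon> x = RN_deriv P Q x"
    using assms(6) by (auto simp: log_utility_optimal_def)
  then have \<epsilon>: "\<epsilon> \<in> borel_measurable P"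
    by (simp add: valid_e_value_def)
  have "density P \<epsilon> = density P (RN_deriv P Q)"
    by (intro density_cong \<epsilon> borel_measurable_RN_deriv ae)
  also have "\<dots> = Q"
    by (rule P.density_RN_deriv[OF assms(4,3)])
  finally have "density (restr_to_subalg P Fn) (nn_cond_exp P Fn \<epsilon>) = restr_to_subalg Q Fn"
    using density_nn_cond_exp[OF \<epsilon>] by simp
  then have "AE x in restr_to_subalg P Fn.
      nn_cond_exp P Fn \<epsilon> x = RN_deriv (restr_to_subalg P Fn) (restr_to_subalg Q Fn) x"
    by (intro PF.RN_deriv_unique measurable_in_subalg[OF subalg] borel_measurable_nn_cond_exp)
  with valid_e_value_nn_cond_exp[OF valid] show ?thesis
    by (simp add: log_utility_optimal_def)
qed

end
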